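(* Let $E$ be a unital Banach algebra, $a<b$, and let $\mathcal I$ be the set of all compact subintervals of $[a,b]$. Assume that $V:[a,b]\times\mathcal I\to E$ is strongly Kurzweil product integrable and satisfies conditions (V1)--(V4) listed in the context. Then the indefinite product integral $W(t)=\prod_a^tV(s,\mathrm ds)$, $t\in[a,b]$, is a strong Kurzweil-Henstock solution of the linear generalized differential equation $$x(s)=x(a)+\int_a^sD_t[U(\tau,t)x(\tau)],\quad s\in[a,b],$$ where $U$ is given by $$U(\tau,t)=\begin{cases}V(\tau,[\tau,t]),&t\ge\tau,\\ V(\tau,[t,\tau])^{-1},&t<\tau.\end{cases}$$
   Context: A unital Banach algebra is a complete normed algebra with unit $I$, $\|I\|=1$. $\mathcal I$ includes degenerate intervals $[t,t]$. Conditions: (V1) $V(t,[t,t])=I$ for every $t\in[a,b]$. (V2) For every $t\in[a,b]$ and $\varepsilon>0$ there is $\sigma>0$ such that $\|V(t,[x,y])-V(t,[t,y])V(t,[x,t])\|<\varepsilon$ for all $x,y\in[a,b]$ with $t-\sigma<x\le t\le y<t+\sigma$. (V3) For every $t\in[a,b)$ there is an invertible $V_+(t)\in E$ with $\lim_{y\to t+}V(t,[t,y])=V_+(t)$. (V4) For every $t\in(a,b]$ there is an invertible $V_-(t)\in E$ with $\lim_{x\to t-}V(t,[x,t])=V_-(t)$. Tagged partition of $[a,b]$: $(\xi_i,[t_{i-1},t_i])_{i=1}^m$ with $a=t_0<\dots<t_m=b$, $\xi_i\in[t_{i-1},t_i]$; for a gauge $\delta:[a,b]\to\mathbb R^+$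 it is $\delta$-fine if $[t_{i-1},t_i]\subset(\xi_i-\delta(\xi_i),\xi_i+\delta(\xi_i))$ for all $i$. $V$ is strongly Kurzweil product integrable on $[a,b]$ if there is $W_0:[a,b]\to E$ with $W_0(t)$ invertible for all $t$, $W_0$ and $W_0^{-1}$ bounded, such that for every $\varepsilon>0$ there is a gauge $\delta$ with $\sum_{i=1}^m\|V(\xi_i,[t_{i-1},t_i])-W_0(t_i)W_0(t_{i-1})^{-1}\|<\varepsilon$ for every $\delta$-fine tagged partition of $[a,b]$; then $\prod_a^bV(t,\mathrm dt)=W_0(b)W_0(a)^{-1}$. (Integrability on $[a,b]$ implies integrability on $[a,t]$ with value $W_0(t)W_0(a)^{-1}$; $\prod_a^aV(s,\mathrm ds)=I$.) Strong Kurzweil-Henstock solution: given $U$ with values $U(\tau,t)\in E$ for $\tau,t\in[a,b]$, a function $x:[a,b]\to E$ is a strong Kurzweil-Henstock solution of the linear generalized differential equation $x(s)=x(a)+\int_a^sD_t[U(\tau,t)x(\tau)]$, $s\in[a,b]$, if for every $\varepsilon>0$ there is a gauge $\delta$ on $[a,b]$ such that $\sum_{i=1}^m\|x(t_i)-x(t_{i-1})-(U(\xi_i,t_i)-U(\xi_i,t_{i-1}))x(\xi_i)\|<\varepsilon$ for every $\delta$-fine tagged partition of $[a,b]$. It suffices that for each $\tau$, $U(\tau,t)$ is defined for $t\in[a,b]$ sufficiently close to $\tau$ (gauges are then taken small enough that only defined values occur); under (V4) the inverse $V(\tau,[t,\tau])^{-1}$ in the definition of $U$ exists for $t<\tau$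 close to $\tau$. *)

theory Defs
  imports "HOL-Analysis.Analysis"
begin

text \<open>
  A unital Banach algebra is a type of sort \<open>{real_normed_algebra_1, banach}\<close>; scalars are real,
  which includes complex algebras by restriction of scalars. The library has no partial inverse
  for this sort.
\<close>

definition alg_invertible :: "'a::monoid_mult \<Rightarrow> bool"
  where "alg_invertible x \<longleftrightarrow> (\<exists>y. x * y = 1 \<and> y * x = 1)"

text \<open>Two-sided inverse, meaningful only under \<^const>\<open>alg_invertible\<close>.\<close>

definition alg_inverse :: "'a::monoid_mult \<Rightarrow> 'a"
  where "alg_inverse x = (THE y. x * y = 1 \<and> y * x = 1)"

text \<open>
  The tag \<open>\<xi> i\<close> belongs to \<open>[t i, t (i + 1)]\<close> for \<open>i < m\<close>, that is, tags are numbered from \<open>0\<close>.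
  If \<open>a < b\<close> then \<open>m > 0\<close> automatically.
\<close>

definition tagged_partition ::
    "real \<Rightarrow> real \<Rightarrow> nat \<Rightarrow> (nat \<Rightarrow> real) \<Rightarrow> (nat \<Rightarrow> real) \<Rightarrow> bool"
  where "tagged_partition a b m t \<xi> \<longleftrightarrow>
    t 0 = a \<and> t m = b \<and> (\<forall>i<m. t i < t (Suc i) \<and> \<xi> i \<in> {t i..t (Suc i)})"

definition gauge_on :: "real \<Rightarrow> real \<Rightarrow> (real \<Rightarrow> real) \<Rightarrow> bool"
  where "gauge_on a b \<delta> \<longleftrightarrow> (\<forall>s\<in>{a..b}. \<delta> s > 0)"

definition fine_partition ::
    "(real \<Rightarrow> real) \<Rightarrow> real \<Rightarrow> real \<Rightarrow> nat \<Rightarrow> (nat \<Rightarrow> real) \<Rightarrow> (nat \<Rightarrow> real) \<Rightarrow> bool"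
  where "fine_partition \<delta> a b m t \<xi> \<longleftrightarrow>
    tagged_partition a b m t \<xi> \<and>
    (\<forall>i<m. {t i..t (Suc i)} \<subseteq> {\<xi> i - \<delta> (\<xi> i)<..<\<xi> i + \<delta> (\<xi> i)})"

text \<open>
  An interval function \<open>V\<close> takes a tag and a compact interval, as a set; only its values
  \<open>V s {x..y}\<close> with \<open>s \<in> {a..b}\<close> and \<open>a \<le> x \<le> y \<le> b\<close> are relevant.
\<close>

definition product_primitive ::
    "(real \<Rightarrow> real set \<Rightarrow> 'a::{real_normed_algebra_1,banach}) \<Rightarrow> real \<Rightarrow> real \<Rightarrow> (real \<Rightarrow> 'a) \<Rightarrow> bool"
  where "product_primitive V a b W0 \<longleftrightarrow>
    (\<forall>s\<in>{a..b}. alg_invertible (W0 s)) \<and>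
    bounded (W0 ` {a..b}) \<and>
    bounded ((\<lambda>s. alg_inverse (W0 s)) ` {a..b}) \<and>
    (\<forall>\<epsilon>>0. \<exists>\<delta>. gauge_on a b \<delta> \<and>
      (\<forall>m t \<xi>. fine_partition \<delta> a b m t \<xi> \<longrightarrow>
        (\<Sum>i<m. norm (V (\<xi> i) {t i..t (Suc i)} - W0 (t (Suc i)) * alg_inverse (W0 (t i)))) < \<epsilon>))"

definition strongly_product_integrable ::
    "(real \<Rightarrow> real set \<Rightarrow> 'a::{real_normed_algebra_1,banach}) \<Rightarrow> real \<Rightarrow> real \<Rightarrow> bool"
  where "strongly_product_integrable V a b \<longleftrightarrow> (\<exists>W0. product_primitive V a b W0)"

text \<open>The value does not depend on the choice of \<open>W0\<close>, so the description below is unique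
  whenever \<open>V\<close> is strongly product integrable.\<close>

definition product_integral ::
    "(real \<Rightarrow> real set \<Rightarrow> 'a::{real_normed_algebra_1,banach}) \<Rightarrow> real \<Rightarrow> real \<Rightarrow> 'a"
  where "product_integral V a b =
    (if a = b then 1
     else THE w. \<exists>W0. product_primitive V a b W0 \<and> w = W0 b * alg_inverse (W0 a))"

definition V1 :: "(real \<Rightarrow> real set \<Rightarrow> 'a::{real_normed_algebra_1,banach}) \<Rightarrow> real \<Rightarrow> real \<Rightarrow> bool"
  where "V1 V a b \<longleftrightarrow> (\<forall>t\<in>{a..b}. V t {t..t} = 1)"

definition V2 :: "(real \<Rightarrow> real set \<Rightarrow> 'a::{real_normed_algebra_1,banach}) \<Rightarrow> real \<Rightarrow> real \<Rightarrow> bool"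
  where "V2 V a b \<longleftrightarrow> (\<forall>t\<in>{a..b}. \<forall>\<epsilon>>0. \<exists>\<sigma>>0. \<forall>x\<in>{a..b}. \<forall>y\<in>{a..b}.
    t - \<sigma> < x \<and> x \<le> t \<and> t \<le> y \<and> y < t + \<sigma> \<longrightarrow>
    norm (V t {x..y} - V t {t..y} * V t {x..t}) < \<epsilon>)"

definition V3 :: "(real \<Rightarrow> real set \<Rightarrow> 'a::{real_normed_algebra_1,banach}) \<Rightarrow> real \<Rightarrow> real \<Rightarrow> bool"
  where "V3 V a b \<longleftrightarrow> (\<forall>t\<in>{a..<b}. \<exists>Vp. alg_invertible Vp \<and>
    ((\<lambda>y. V t {t..y}) \<longlongrightarrow> Vp) (at_right t))"

definition V4 :: "(real \<Rightarrow> real set \<Rightarrow> 'a::{real_normed_algebra_1,banach}) \<Rightarrow> real \<Rightarrow> real \<Rightarrow> bool"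
  where "V4 V a b \<longleftrightarrow> (\<forall>t\<in>{a<..b}. \<exists>Vm. alg_invertible Vm \<and>
    ((\<lambda>x. V t {x..t}) \<longlongrightarrow> Vm) (at_left t))"

text \<open>
  Solutions of \<open>x(s) = x(a) + \<integral>\<^sub>a\<^sup>s D\<^sub>t[U(\<tau>,t) x(\<tau>)]\<close>, \<open>s \<in> [a,b]\<close>. The function \<open>U\<close> may be partial:
  \<open>D \<tau>\<close> is the set of those \<open>t\<close> for which \<open>U \<tau> t\<close> is defined, and the gauge has to be so small
  that only defined values occur in the sums. For \<open>U\<close> defined on all of \<open>[a,b] \<times> [a,b]\<close> take
  \<open>D = (\<lambda>\<tau>. UNIV)\<close>.
\<close>

definition strong_KH_solution ::
    "(real \<Rightarrow> real set) \<Rightarrow> (real \<Rightarrow> real \<Rightarrow> 'a::{real_normed_algebra_1,banach})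
      \<Rightarrow> real \<Rightarrow> real \<Rightarrow> (real \<Rightarrow> 'a) \<Rightarrow> bool"
  where "strong_KH_solution D U a b x \<longleftrightarrow>
    (\<forall>\<epsilon>>0. \<exists>\<delta>. gauge_on a b \<delta> \<and>
      (\<forall>m t \<xi>. fine_partition \<delta> a b m t \<xi> \<longrightarrow>
        (\<forall>i<m. t i \<in> D (\<xi> i) \<and> t (Suc i) \<in> D (\<xi> i)) \<and>
        (\<Sum>i<m. norm (x (t (Suc i)) - x (t i) - (U (\<xi> i) (t (Suc i)) - U (\<xi> i) (t i)) * x (\<xi> i)))
          < \<epsilon>))"

definition U_of ::
    "(real \<Rightarrow> real set \<Rightarrow> 'a::{real_normed_algebra_1,banach}) \<Rightarrow> real \<Rightarrow> real \<Rightarrow> 'a"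
  where "U_of V \<tau> t = (if t \<ge> \<tau> then V \<tau> {\<tau>..t} else alg_inverse (V \<tau> {t..\<tau>}))"

definition U_dom ::
    "(real \<Rightarrow> real set \<Rightarrow> 'a::{real_normed_algebra_1,banach}) \<Rightarrow> real \<Rightarrow> real set"
  where "U_dom V \<tau> = {t. t \<ge> \<tau> \<or> alg_invertible (V \<tau> {t..\<tau>})}"

end

theory Submission
  imports Defs
begin

text \<open>
  Splitting each interval of a fine tagged partition at its tag, and keeping the tag for both
  halves, gives a fine tagged partition again. Hence strong product integrability with primitive
  \<open>W\<^sub>0\<close> controls the sums of \<open>\<parallel>V(\<xi>, [\<xi>, t]) - W\<^sub>0(t) W\<^sub>0(\<xi>)\<^sup>-\<^sup>1\<parallel>\<close> and
  \<open>\<parallel>V(\<xi>, [s, \<xi>]) - W\<^sub>0(\<xi>) W\<^sub>0(s)\<^sup>-\<^sup>1\<parallel>\<close>; the degenerate halves contribute nothing by (V1). Since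
  \<open>W\<^sub>0\<close> and its inverse are bounded, a Neumann series makes \<open>V(\<xi>, [s, \<xi>])\<close> invertible with an
  inverse that is bounded uniformly in \<open>\<xi>\<close> and \<open>s\<close>, and the second estimate carries over to the
  inverses.
\<close>

subsection \<open>Inverses in Banach algebras\<close>

lemma alg_inverse_eqI:
  fixes x :: "'a::monoid_mult"
  assumes "x * y = 1" "y * x = 1"
  shows "alg_inverse x = y"
  unfolding alg_inverse_def
proof (rule the_equality)
  fix z assume "x * z = 1 \<and> z * x = 1"
  then show "z = y"
    using assms by (metis mult.assoc mult_1_left mult_1_right)
qed (use assms in auto)

lemma
  fixes x :: "'a::monoid_mult"
  assumes "alg_invertible x"
  shows alg_inverse_right: "x * alg_inverse x = 1"
    and alg_inverse_left: "alg_inverse x * x = 1"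
  using assms alg_inverse_eqI unfolding alg_invertible_def by metis+

lemma
  fixes x :: "'a::monoid_mult"
  assumes "alg_invertible x"
  shows alg_inverse_right_assoc: "x * (alg_inverse x * z) = z"
    and alg_inverse_left_assoc: "alg_inverse x * (x * z) = z"
  using alg_inverse_right[OF assms] alg_inverse_left[OF assms]
  by (simp_all flip: mult.assoc)

lemma alg_invertible_mult:
  fixes x :: "'a::monoid_mult"
  assumes "alg_invertible x" "alg_invertible y"
  shows "alg_invertible (x * y)"
  unfolding alg_invertible_def
  using assms by (intro exI[of _ "alg_inverse y * alg_inverse x"])
    (simp add: mult.assoc alg_inverse_right alg_inverse_left
      alg_inverse_right_assoc alg_inverse_left_assoc)

text \<open>Neumann series: \<open>s\<close>, the sum of all powers of \<open>y\<close>, satisfies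
  \<open>s = 1 + y * s\<close> and \<open>s = 1 + s * y\<close>, so it inverts \<open>1 - y\<close>
  on both sides.\<close>

lemma alg_invertible_one_minus:
  fixes y :: "'a::{real_normed_algebra_1,banach}"
  assumes "norm y < 1"
  shows "alg_invertible (1 - y)"
proof -
  have sm: "summable (\<lambda>n. y ^ n)"
    by (rule complete_algebra_summable_geometric[OF assms])
  define s where "s = (\<Sum>n. y ^ n)"
  have s: "s = 1 + (\<Sum>n. y ^ Suc n)"
    using suminf_split_head[OF sm] by (simp add: s_def)
  have "(\<Sum>n. y ^ Suc n) = y * s" "(\<Sum>n. y ^ Suc n) = s * y"
    using suminf_mult[OF sm, of y] suminf_mult2[OF sm, of y]
    by (simp_all add: s_def power_commutes)
  then show ?thesis
    using s unfolding alg_invertible_def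
    by (intro exI[of _ s]) (simp add: algebra_simps)
qed

text \<open>Factor \<open>B = A * (1 - A' * (A - B))\<close>; the second factor differs from 1 by at
  most 1/2 in norm. The estimates depend on \<open>A\<close> only through the bound
  \<open>N\<close>, which is what makes them uniform over tags and intervals later.\<close>

lemma alg_invertible_perturbation:
  fixes A B A' :: "'a::{real_normed_algebra_1,banach}"
  assumes A: "A * A' = 1" "A' * A = 1"
    and N: "norm A' \<le> N" and small: "N * norm (B - A) \<le> 1 / 2"
  shows "alg_invertible B"
    and "norm (alg_inverse B) \<le> 2 * N"
    and "norm (A' - alg_inverse B) \<le> 2 * N\<^sup>2 * norm (B - A)"
proof -
  have le: "norm (A' * (B - A)) \<le> 1 / 2"
    using norm_mult_ineq[of A' "B - A"] mult_right_mono[OF N norm_ge_zero[of "B - A"]] small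
    by linarith
  have "B = A * (1 - A' * (A - B))"
    using A by (simp add: algebra_simps flip: mult.assoc)
  moreover have "alg_invertible (1 - A' * (A - B))"
    using le by (intro alg_invertible_one_minus) (simp add: algebra_simps norm_minus_commute)
  moreover have "alg_invertible A"
    using A unfolding alg_invertible_def by blast
  ultimately show inv: "alg_invertible B"
    using alg_invertible_mult by metis
  define C where "C = alg_inverse B"
  have C: "B * C = 1"
    using inv by (simp add: C_def alg_inverse_right)
  \<comment> \<open>Resolvent identity. It is used twice: first to bound \<open>C\<close>, then,
    with that bound available, to estimate the difference linearly in
    \<open>norm (B - A)\<close>.\<close>
  have diff: "A' - C = A' * (B - A) * C"
    using A C by (simp add: algebra_simps)
  have "norm (A' - C) \<le> norm (A' * (B - A)) * norm C"
    unfolding diff by (rule norm_mult_ineq)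
  also have "\<dots> \<le> 1 / 2 * norm C"
    using le by (rule mult_right_mono) simp
  \<comment> \<open>Absorption: \<open>norm C\<close> is at most
    \<open>norm A' + norm C / 2\<close>.\<close>
  finally show C2: "norm (alg_inverse B) \<le> 2 * N"
    using N norm_triangle_ineq2[of C A'] by (simp add: C_def norm_minus_commute)
  have "norm (A' - C) \<le> norm (A' * (B - A)) * norm C"
    unfolding diff by (rule norm_mult_ineq)
  also have "\<dots> \<le> (N * norm (B - A)) * (2 * N)"
  proof (rule mult_mono)
    show "norm (A' * (B - A)) \<le> N * norm (B - A)"
      using norm_mult_ineq[of A' "B - A"] mult_right_mono[OF N norm_ge_zero[of "B - A"]]
      by linarith
    show "0 \<le> N * norm (B - A)"
      using order_trans[OF norm_ge_zero N] by simp
  qed (use C2 in \<open>auto simp: C_def\<close>)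
  finally show "norm (A' - alg_inverse B) \<le> 2 * N\<^sup>2 * norm (B - A)"
    by (simp add: C_def power2_eq_square algebra_simps)
qed

subsection \<open>Sums over fine partitions\<close>

text \<open>The Riemann-type sums of \<open>F\<close> (tag, left end, right end) as a relation that
  hides the partition. Partitions can then be lengthened interval by interval, tracking only the
  right end and the sum; the empty partition with \<open>m = 0\<close> is the starting
  point.\<close>

definition fine_sum ::
    "(real \<Rightarrow> real) \<Rightarrow> (real \<Rightarrow> real \<Rightarrow> real \<Rightarrow> real) \<Rightarrow> real \<Rightarrow> real \<Rightarrow> real \<Rightarrow> bool"
  where "fine_sum \<delta> F a c S \<longleftrightarrow>
    (\<exists>m t \<xi>. fine_partition \<delta> a c m t \<xi> \<and> S = (\<Sum>i<m. F (\<xi> i) (t i) (t (Suc i))))"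

lemma fine_sum_empty: "fine_sum \<delta> F a a 0"
  unfolding fine_sum_def fine_partition_def tagged_partition_def
  by (intro exI[of _ 0] exI[of _ "\<lambda>_. a"]) simp

lemma fine_sum_append:
  assumes "fine_sum \<delta> F a c S" "c < d" "x \<in> {c..d}" "{c..d} \<subseteq> {x - \<delta> x<..<x + \<delta> x}"
  shows "fine_sum \<delta> F a d (S + F x c d)"
proof -
  obtain m t \<xi> where p: "fine_partition \<delta> a c m t \<xi>"
    and S: "S = (\<Sum>i<m. F (\<xi> i) (t i) (t (Suc i)))"
    using assms(1) unfolding fine_sum_def by blast
  \<comment> \<open>Tags are numbered from 0: the new endpoint gets index \<open>Suc m\<close>, the
    new tag index \<open>m\<close>, and \<open>t m = c\<close> is kept as the left end.\<close>
  define t' where "t' = t(Suc m := d)"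
  define \<xi>' where "\<xi>' = \<xi>(m := x)"
  have "fine_partition \<delta> a d (Suc m) t' \<xi>'"
    using p assms(2-) unfolding fine_partition_def tagged_partition_def
    by (auto simp: t'_def \<xi>'_def less_Suc_eq)
  moreover have "(\<Sum>i<Suc m. F (\<xi>' i) (t' i) (t' (Suc i))) = S + F x c d"
    using p unfolding S fine_partition_def tagged_partition_def
    by (simp add: t'_def \<xi>'_def)
  ultimately show ?thesis
    unfolding fine_sum_def by metis
qed

text \<open>Cousin's lemma, by bisection.\<close>

lemma fine_sum_extend:
  assumes g: "gauge_on a b \<delta>" and F: "\<And>x u v. F x u v \<ge> 0"
    and c: "a \<le> c" "c \<le> b" and S: "fine_sum \<delta> F a c S"
  shows "\<exists>S'\<ge>S. fine_sum \<delta> F a b S'"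
proof -
  \<comment> \<open>Quantified over \<open>S\<close>, the claim is transitive in its two ends, as
    \<open>Bolzano\<close> requires. What remains is a short interval around a point
    \<open>x\<close>, covered by a single piece with tag \<open>x\<close>.\<close>
  have "\<forall>S. fine_sum \<delta> F a c S \<longrightarrow> (\<exists>S'\<ge>S. fine_sum \<delta> F a b S')"
    using c(2)
  proof (induction rule: Bolzano)
    case (trans u v w)
    then show ?case by (meson order_trans)
  next
    case (local x)
    then have "\<delta> x > 0"
      using g c by (auto simp: gauge_on_def)
    moreover have "\<exists>S'\<ge>S. fine_sum \<delta> F a v S'"
      if "u \<le> x" "x \<le> v" "v - u < \<delta> x" "fine_sum \<delta> F a u S" for u v S
    proof (cases "u = v")
      case False
      then have "fine_sum \<delta> F a v (S + F x u v)"
        using that by (intro fine_sum_append) auto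
      then show ?thesis
        using F by (metis le_add_same_cancel1)
    qed (use that in auto)
    ultimately show ?case by blast
  qed
  then show ?thesis using S by blast
qed

lemma fine_partition_in_range:
  assumes "fine_partition \<delta> a b m t \<xi>" "i \<le> m"
  shows "a \<le> t i" "t i \<le> b"
proof -
  have t: "t 0 = a" "t m = b" "\<And>i. i < m \<Longrightarrow> t i \<le> t (Suc i)"
    using assms(1) unfolding fine_partition_def tagged_partition_def by (auto simp: less_imp_le)
  have "i \<le> m \<longrightarrow> t 0 \<le> t i"
    by (induction i) (use t(3) in \<open>auto simp: Suc_le_eq intro: order_trans\<close>)
  then show "a \<le> t i"
    using assms t by simp
  show "t i \<le> b"
    using assms(2)
    by (induction i rule: inc_induct) (use t in \<open>auto intro: order_trans\<close>)
qed

lemma fine_sum_split: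
  assumes p: "fine_partition \<delta> a b m t \<xi>"
    and F: "\<And>x. x \<in> {a..b} \<Longrightarrow> F x x x = 0"
  shows "fine_sum \<delta> F a b
    (\<Sum>i<m. F (\<xi> i) (t i) (\<xi> i) + F (\<xi> i) (\<xi> i) (t (Suc i)))"
proof -
  \<comment> \<open>A tag may be an endpoint of its interval. Partition points increase strictly, so
    the degenerate half is omitted, and \<open>F x x x = 0\<close> keeps the sum correct.\<close>
  have weak_append: "fine_sum \<delta> F a d (S + F x c d)"
    if "fine_sum \<delta> F a c S" "c \<le> d" "x \<in> {c..d}" "{c..d} \<subseteq> {x - \<delta> x<..<x + \<delta> x}"
       "x \<in> {a..b}" for c d x S
    using that F[of x] fine_sum_append[of \<delta> F a c S d x] by (cases "c = d") auto
  \<comment> \<open>Induction on the number of intervals already split; each step appends the left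
    half and then the right half, both inside the neighbourhood that contained the whole
    interval.\<close>
  have "k \<le> m \<longrightarrow> fine_sum \<delta> F a (t k)
      (\<Sum>i<k. F (\<xi> i) (t i) (\<xi> i) + F (\<xi> i) (\<xi> i) (t (Suc i)))" for k
  proof (induction k)
    case 0
    then show ?case
      using p fine_sum_empty unfolding fine_partition_def tagged_partition_def by simp
  next
    case (Suc k)
    show ?case
    proof
      assume k: "Suc k \<le> m"
      let ?S = "\<Sum>i<k. F (\<xi> i) (t i) (\<xi> i) + F (\<xi> i) (\<xi> i) (t (Suc i))"
      have x: "t k \<le> \<xi> k" "\<xi> k \<le> t (Suc k)"
          "{t k..t (Suc k)} \<subseteq> {\<xi> k - \<delta> (\<xi> k)<..<\<xi> k + \<delta> (\<xi> k)}"
        using p k unfolding fine_partition_def tagged_partition_def by auto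
      have r: "\<xi> k \<in> {a..b}"
        using x(1,2) fine_partition_in_range[OF p, of k] fine_partition_in_range[OF p k] k by auto
      have "fine_sum \<delta> F a (\<xi> k) (?S + F (\<xi> k) (t k) (\<xi> k))"
        using Suc k x r by (intro weak_append[of "t k" ?S]) auto
      then have "fine_sum \<delta> F a (t (Suc k))
          ((?S + F (\<xi> k) (t k) (\<xi> k)) + F (\<xi> k) (\<xi> k) (t (Suc k)))"
        using x r by (intro weak_append[of "\<xi> k"]) auto
      then show "fine_sum \<delta> F a (t (Suc k))
          (\<Sum>i<Suc k. F (\<xi> i) (t i) (\<xi> i) + F (\<xi> i) (\<xi> i) (t (Suc i)))"
        by (simp add: add.assoc)
    qed
  qed
  then have "fine_sum \<delta> F a (t m)
      (\<Sum>i<m. F (\<xi> i) (t i) (\<xi> i) + F (\<xi> i) (\<xi> i) (t (Suc i)))"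
    by blast
  then show ?thesis
    using p unfolding fine_partition_def tagged_partition_def by simp
qed

subsection \<open>The indefinite product integral\<close>

definition primitive_error ::
    "(real \<Rightarrow> real set \<Rightarrow> 'a::{real_normed_algebra_1,banach}) \<Rightarrow> (real \<Rightarrow> 'a)
      \<Rightarrow> real \<Rightarrow> real \<Rightarrow> real \<Rightarrow> real"
  where "primitive_error V W x u v = norm (V x {u..v} - W v * alg_inverse (W u))"

lemma primitive_error_nonneg: "primitive_error V W x u v \<ge> 0"
  by (simp add: primitive_error_def)

lemma product_primitive_gauge:
  assumes "product_primitive V a b W" "\<epsilon> > 0"
  obtains \<delta> where "gauge_on a b \<delta>"
    "\<And>S. fine_sum \<delta> (primitive_error V W) a b S \<Longrightarrow> S < \<epsilon>"
proof -
  obtain \<delta> where "gauge_on a b \<delta>" and "\<forall>m t \<xi>. fine_partition \<delta> a b m t \<xi> \<longrightarrow>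
      (\<Sum>i<m. norm (V (\<xi> i) {t i..t (Suc i)} - W (t (Suc i)) * alg_inverse (W (t i)))) < \<epsilon>"
    using assms unfolding product_primitive_def by blast
  then show thesis
    by (intro that[of \<delta>]) (auto simp: fine_sum_def primitive_error_def)
qed

lemma product_primitive_invertible:
  "product_primitive V a b W \<Longrightarrow> s \<in> {a..b} \<Longrightarrow> alg_invertible (W s)"
  unfolding product_primitive_def by blast

lemma product_primitive_bounds:
  assumes "product_primitive V a b W"
  obtains M where "M \<ge> 1" "\<And>s. s \<in> {a..b} \<Longrightarrow> norm (W s) \<le> M"
    "\<And>s. s \<in> {a..b} \<Longrightarrow> norm (alg_inverse (W s)) \<le> M"
proof -
  obtain M1 M2 where M: "\<forall>s\<in>{a..b}. norm (W s) \<le> M1"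
    "\<forall>s\<in>{a..b}. norm (alg_inverse (W s)) \<le> M2"
    using assms unfolding product_primitive_def bounded_iff by auto
  \<comment> \<open>A bound of at least 1 allows powers of \<open>M\<close> to be compared
    later.\<close>
  show thesis
    by (rule that[of "max 1 (max M1 M2)"]) (use M in \<open>auto simp: le_max_iff_disj\<close>)
qed

text \<open>By Cousin's lemma a fine partition of \<open>[a,c]\<close> extends to one of
  \<open>[a,b]\<close> for the same gauge. Errors are nonnegative, so the sum over the larger
  interval dominates.\<close>

lemma product_primitive_restrict:
  assumes W: "product_primitive V a b W" and c: "a \<le> c" "c \<le> b"
  shows "product_primitive V a c W"
proof -
  have "\<exists>\<delta>. gauge_on a c \<delta> \<and> (\<forall>m t \<xi>. fine_partition \<delta> a c m t \<xi> \<longrightarrow>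
      (\<Sum>i<m. norm (V (\<xi> i) {t i..t (Suc i)} - W (t (Suc i)) * alg_inverse (W (t i)))) < \<epsilon>)"
    if e: "\<epsilon> > 0" for \<epsilon>
  proof -
    obtain \<delta> where g: "gauge_on a b \<delta>"
      and \<delta>: "\<And>S. fine_sum \<delta> (primitive_error V W) a b S \<Longrightarrow> S < \<epsilon>"
      using product_primitive_gauge[OF W e] by blast
    have "S < \<epsilon>" if S: "fine_sum \<delta> (primitive_error V W) a c S" for S
    proof -
      obtain S' where "S \<le> S'" "fine_sum \<delta> (primitive_error V W) a b S'"
        using fine_sum_extend[OF g primitive_error_nonneg c S] by blast
      then show ?thesis
        using \<delta> by (metis order_le_less_trans)
    qed
    moreover have "gauge_on a c \<delta>"
      using g c by (auto simp: gauge_on_def)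
    ultimately show ?thesis
      unfolding fine_sum_def primitive_error_def by (intro exI[of _ \<delta>]) auto
  qed
  moreover have "{a..c} \<subseteq> {a..b}"
    using c by auto
  ultimately show ?thesis
    using W unfolding product_primitive_def
    by (auto elim: bounded_subset)
qed

lemma product_primitive_common_partition:
  assumes W: "product_primitive V a b W" and Z: "product_primitive V a b Z"
    and ab: "a \<le> b" and e: "\<epsilon> > 0"
  obtains m t \<xi> where "tagged_partition a b m t \<xi>" "\<forall>i\<le>m. t i \<in> {a..b}"
    "(\<Sum>i<m. primitive_error V W (\<xi> i) (t i) (t (Suc i))) < \<epsilon>"
    "(\<Sum>i<m. primitive_error V Z (\<xi> i) (t i) (t (Suc i))) < \<epsilon>"
proof -
  obtain \<delta>1 where g1: "gauge_on a b \<delta>1"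
    and \<delta>1: "\<And>S. fine_sum \<delta>1 (primitive_error V W) a b S \<Longrightarrow> S < \<epsilon>"
    using product_primitive_gauge[OF W e] by blast
  obtain \<delta>2 where g2: "gauge_on a b \<delta>2"
    and \<delta>2: "\<And>S. fine_sum \<delta>2 (primitive_error V Z) a b S \<Longrightarrow> S < \<epsilon>"
    using product_primitive_gauge[OF Z e] by blast
  define \<delta> where "\<delta> s = min (\<delta>1 s) (\<delta>2 s)" for s
  have "gauge_on a b \<delta>"
    using g1 g2 by (simp add: gauge_on_def \<delta>_def)
  \<comment> \<open>Existence of a fine partition: the empty one at \<open>a\<close> is extended to
    \<open>b\<close>, with the zero function as a dummy summand.\<close>
  then obtain S where "fine_sum \<delta> (\<lambda>_ _ _. 0) a b S"
    using fine_sum_extend[OF _ order_refl order_refl ab fine_sum_empty] by blast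
  then obtain m t \<xi> where p: "fine_partition \<delta> a b m t \<xi>"
    unfolding fine_sum_def by blast
  have "{x - \<delta> x<..<x + \<delta> x} \<subseteq> {x - \<delta>1 x<..<x + \<delta>1 x} \<inter> {x - \<delta>2 x<..<x + \<delta>2 x}" for x
    by (auto simp: \<delta>_def)
  then have "fine_partition \<delta>1 a b m t \<xi>" "fine_partition \<delta>2 a b m t \<xi>"
    using p unfolding fine_partition_def by (meson le_inf_iff order_trans)+
  then have "fine_sum \<delta>1 F a b (\<Sum>i<m. F (\<xi> i) (t i) (t (Suc i)))"
    "fine_sum \<delta>2 F a b (\<Sum>i<m. F (\<xi> i) (t i) (t (Suc i)))" for F
    unfolding fine_sum_def by blast+
  moreover have "tagged_partition a b m t \<xi>"
    using p by (simp add: fine_partition_def)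
  ultimately show thesis
    using fine_partition_in_range[OF p] by (intro that[of m t \<xi>] \<delta>1 \<delta>2) auto
qed

text \<open>The function \<open>W\<^sup>-\<^sup>1 Z\<close> has increments of arbitrarily small total size.\<close>

lemma product_primitive_unique:
  fixes W Z :: "real \<Rightarrow> 'a::{real_normed_algebra_1,banach}"
  assumes W: "product_primitive V a b W" and Z: "product_primitive V a b Z" and ab: "a \<le> b"
  shows "Z b * alg_inverse (Z a) = W b * alg_inverse (W a)"
proof -
  obtain M where M: "M \<ge> 1" "\<And>s. s \<in> {a..b} \<Longrightarrow> norm (alg_inverse (W s)) \<le> M"
    using product_primitive_bounds[OF W] by metis
  obtain N where N: "N \<ge> 1" "\<And>s. s \<in> {a..b} \<Longrightarrow> norm (Z s) \<le> N"
    using product_primitive_bounds[OF Z] by metis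
  note inv = product_primitive_invertible[OF W] product_primitive_invertible[OF Z]
  define Y where "Y s = alg_inverse (W s) * Z s" for s
  let ?F = "primitive_error V W" and ?G = "primitive_error V Z"
  have step: "norm (Y v - Y u) \<le> M * N * (?F x u v + ?G x u v)"
    if "u \<in> {a..b}" "v \<in> {a..b}" for u v x
  proof -
    \<comment> \<open>The value of \<open>V\<close> on \<open>[u,v]\<close> cancels in
      \<open>D\<close>, so the two primitives are compared through their errors alone.\<close>
    define D where "D = Z v * alg_inverse (Z u) - W v * alg_inverse (W u)"
    have "D = (V x {u..v} - W v * alg_inverse (W u)) - (V x {u..v} - Z v * alg_inverse (Z u))"
      by (simp add: D_def)
    then have D: "norm D \<le> ?F x u v + ?G x u v"
      unfolding primitive_error_def by (simp only: norm_triangle_ineq4)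
    have "Y v - Y u = alg_inverse (W v) * D * Z u"
      using that inv by (simp add: Y_def D_def algebra_simps alg_inverse_left
          alg_inverse_left_assoc)
    then have "norm (Y v - Y u) \<le> norm (alg_inverse (W v)) * norm D * norm (Z u)"
      by (simp add: order_trans[OF norm_mult_ineq] mult_right_mono norm_mult_ineq)
    also have "\<dots> \<le> M * norm D * N"
      using M N that by (intro mult_mono) auto
    also have "\<dots> \<le> M * N * (?F x u v + ?G x u v)"
      using mult_left_mono[OF D, of "M * N"] M(1) N(1) by (simp add: mult_ac)
    finally show ?thesis .
  qed
  have "norm (Y b - Y a) \<le> 0 + e" if "e > 0" for e
  proof -
    \<comment> \<open>Two error sums, each multiplied by \<open>M * N\<close>, have to add up to
      \<open>e\<close>.\<close>
    have "e / (2 * M * N) > 0"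
      using that M N by simp
    then obtain m t \<xi> where p: "tagged_partition a b m t \<xi>" "\<forall>i\<le>m. t i \<in> {a..b}"
      and s: "(\<Sum>i<m. ?F (\<xi> i) (t i) (t (Suc i))) < e / (2 * M * N)"
      "(\<Sum>i<m. ?G (\<xi> i) (t i) (t (Suc i))) < e / (2 * M * N)"
      by (rule product_primitive_common_partition[OF W Z ab]) (rule that)
    have "Y b - Y a = (\<Sum>i<m. Y (t (Suc i)) - Y (t i))"
      using p(1) sum_lessThan_telescope[of "\<lambda>i. Y (t i)" m]
      by (simp add: tagged_partition_def)
    also have "norm \<dots> \<le> (\<Sum>i<m. M * N *
        (?F (\<xi> i) (t i) (t (Suc i)) + ?G (\<xi> i) (t i) (t (Suc i))))"
      using p(2) by (intro sum_norm_le step) auto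
    also have "\<dots> = M * N * ((\<Sum>i<m. ?F (\<xi> i) (t i) (t (Suc i)))
        + (\<Sum>i<m. ?G (\<xi> i) (t i) (t (Suc i))))"
      by (simp add: sum_distrib_left sum.distrib distrib_left)
    also have "\<dots> \<le> M * N * (e / (2 * M * N) + e / (2 * M * N))"
      using s M(1) N(1) by (intro mult_left_mono add_mono) auto
    also have "\<dots> = e"
      using M(1) N(1) by simp
    finally show ?thesis by simp
  qed
  then have "norm (Y b - Y a) \<le> 0"
    by (rule field_le_epsilon)
  \<comment> \<open>From \<open>Y b = Y a\<close>: the outer factors turn the left side into the
    quotient of \<open>Z\<close> and the right side into that of \<open>W\<close>.\<close>
  then have "W b * Y b * alg_inverse (Z a) = W b * Y a * alg_inverse (Z a)"
    by simp
  then show ?thesis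
    using inv ab by (simp add: Y_def mult.assoc alg_inverse_right alg_inverse_right_assoc)
qed

text \<open>\<open>W\<close> is a primitive on \<open>[a,c]\<close> too, and uniqueness there
  determines the description in \<open>product_integral\<close>. For \<open>c = a\<close> both sides
  are 1.\<close>

lemma product_integral_eq:
  assumes W: "product_primitive V a b W" and c: "c \<in> {a..b}"
  shows "product_integral V a c = W c * alg_inverse (W a)"
proof (cases "a = c")
  case True
  then show ?thesis
    using product_primitive_invertible[OF W c] by (simp add: product_integral_def alg_inverse_right)
next
  case False
  have Wc: "product_primitive V a c W"
    using product_primitive_restrict[OF W] c by auto
  have "(THE w. \<exists>W0. product_primitive V a c W0 \<and> w = W0 c * alg_inverse (W0 a))
      = W c * alg_inverse (W a)"
  proof (rule the_equality)
    show "w = W c * alg_inverse (W a)"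
      if "\<exists>W0. product_primitive V a c W0 \<and> w = W0 c * alg_inverse (W0 a)" for w
      using that product_primitive_unique[OF Wc] c by auto
  qed (use Wc in blast)
  then show ?thesis
    using False by (simp add: product_integral_def)
qed

subsection \<open>The generalized differential equation\<close>

text \<open>The residual is split at the tag: \<open>U_of V x t * W x\<close> is compared with
  \<open>W t\<close>, and \<open>U_of V x s * W x\<close> with \<open>W s\<close>. On the left,
  \<open>V x {s..x}\<close> is a perturbation of \<open>A\<close>, whose inverse \<open>A'\<close>
  has norm at most \<open>M\<^sup>2\<close>; \<open>small\<close> is the perturbation condition for
  \<open>N = M\<^sup>2\<close>.\<close>

lemma U_of_estimate:
  fixes V :: "real \<Rightarrow> real set \<Rightarrow> 'a::{real_normed_algebra_1,banach}"
  assumes W: "alg_invertible (W s)" "alg_invertible (W x)"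
    and M: "M \<ge> 1" "norm (W s) \<le> M" "norm (W x) \<le> M" "norm (alg_inverse (W x)) \<le> M"
    and V: "V x {x..x} = 1" and sx: "s \<le> x" "x \<le> t"
    and small: "M\<^sup>2 * primitive_error V W x s x \<le> 1 / 2"
  shows "s \<in> U_dom V x"
    and "norm (W t - W s - (U_of V x t - U_of V x s) * W x)
      \<le> 2 * M ^ 5 * (primitive_error V W x s x + primitive_error V W x x t)"
proof -
  define A where "A = W x * alg_inverse (W s)"
  define A' where "A' = W s * alg_inverse (W x)"
  define B where "B = V x {s..x}"
  have e: "primitive_error V W x s x = norm (B - A)"
    by (simp add: primitive_error_def A_def B_def)
  have A: "A * A' = 1" "A' * A = 1"
    using W by (simp_all add: A_def A'_def mult.assoc alg_inverse_right
        alg_inverse_left_assoc)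
  have "norm A' \<le> norm (W s) * norm (alg_inverse (W x))"
    unfolding A'_def by (rule norm_mult_ineq)
  also have "\<dots> \<le> M\<^sup>2"
    using M unfolding power2_eq_square by (intro mult_mono) auto
  finally have N: "norm A' \<le> M\<^sup>2" .
  note B = alg_invertible_perturbation[OF A N small[unfolded e]]
  show "s \<in> U_dom V x"
    using B(1) by (simp add: U_dom_def B_def)
  \<comment> \<open>At \<open>s = x\<close> the definition takes the branch without inverse; both
    branches agree since \<open>V x {x..x} = 1\<close>.\<close>
  have Us: "U_of V x s = alg_inverse B"
  proof (cases "s = x")
    case True
    then show ?thesis
      using V alg_inverse_eqI[of 1 1] by (simp add: U_of_def B_def)
  qed (use sx in \<open>simp add: U_of_def B_def\<close>)
  have "norm (W s - U_of V x s * W x) = norm ((A' - alg_inverse B) * W x)"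
    using W by (simp add: Us A'_def algebra_simps alg_inverse_left)
  \<comment> \<open>The perturbation lemma contributes the fourth power of \<open>M\<close>, and
    \<open>W x\<close> one more factor.\<close>
  also have "\<dots> \<le> (2 * (M\<^sup>2)\<^sup>2 * norm (B - A)) * M"
    using B(3) M by (intro order_trans[OF norm_mult_ineq] mult_mono) auto
  also have "\<dots> = 2 * M ^ 5 * norm (B - A)"
    by (simp add: power_numeral_reduce)
  finally have left: "norm (W s - U_of V x s * W x) \<le> 2 * M ^ 5 * primitive_error V W x s x"
    by (simp add: e)
  have "W t - U_of V x t * W x = - ((V x {x..t} - W t * alg_inverse (W x)) * W x)"
    using W sx by (simp add: U_of_def algebra_simps alg_inverse_left)
  then have "norm (W t - U_of V x t * W x)
      = norm ((V x {x..t} - W t * alg_inverse (W x)) * W x)"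
    by simp
  also have "\<dots> \<le> primitive_error V W x x t * M"
    unfolding primitive_error_def using M
    by (intro order_trans[OF norm_mult_ineq] mult_mono) auto
  \<comment> \<open>The right half involves no inversion and costs only \<open>M\<close>; the
    constant is enlarged to match the left half.\<close>
  also have "\<dots> \<le> primitive_error V W x x t * (2 * M ^ 5)"
  proof (rule mult_left_mono)
    have "M ^ 1 \<le> M ^ 5"
      using M by (intro power_increasing) auto
    then show "M \<le> 2 * M ^ 5"
      using M by simp
  qed (simp add: primitive_error_nonneg)
  finally have right: "norm (W t - U_of V x t * W x) \<le> 2 * M ^ 5 * primitive_error V W x x t"
    by (simp add: mult.commute)
  have eq: "W t - W s - (U_of V x t - U_of V x s) * W x
      = (W t - U_of V x t * W x) - (W s - U_of V x s * W x)"
    by (simp add: algebra_simps)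
  show "norm (W t - W s - (U_of V x t - U_of V x s) * W x)
      \<le> 2 * M ^ 5 * (primitive_error V W x s x + primitive_error V W x x t)"
    using left right norm_triangle_ineq4[of "W t - U_of V x t * W x" "W s - U_of V x s * W x"]
    unfolding eq distrib_left by linarith
qed

theorem theorem8p3:
  fixes V :: "real \<Rightarrow> real set \<Rightarrow> 'a::{real_normed_algebra_1,banach}"
    and a b :: real
  assumes "a < b"
    and "strongly_product_integrable V a b"
    and "V1 V a b" and "V2 V a b" and "V3 V a b" and "V4 V a b"
  shows "strong_KH_solution (U_dom V) (U_of V) a b (\<lambda>t. product_integral V a t)"
  unfolding strong_KH_solution_def
proof (intro allI impI)
  fix \<epsilon> :: real assume \<epsilon>: "\<epsilon> > 0"
  obtain W where W: "product_primitive V a b W"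
    using assms(2) unfolding strongly_product_integrable_def by blast
  obtain M where M: "M \<ge> 1" "\<And>s. s \<in> {a..b} \<Longrightarrow> norm (W s) \<le> M"
    "\<And>s. s \<in> {a..b} \<Longrightarrow> norm (alg_inverse (W s)) \<le> M"
    using product_primitive_bounds[OF W] by blast
  note inv = product_primitive_invertible[OF W]
  let ?F = "primitive_error V W"
  \<comment> \<open>The first bound pays for \<open>2 * M ^ 5\<close> from
    \<open>U_of_estimate\<close> and one more \<open>M\<close> from the inverse of
    \<open>W a\<close>; the second ensures invertibility on every left half.\<close>
  define \<eta> where "\<eta> = min (\<epsilon> / (2 * M ^ 6)) (1 / (2 * M\<^sup>2))"
  have "\<eta> \<le> \<epsilon> / (2 * M ^ 6)" "\<eta> \<le> 1 / (2 * M\<^sup>2)"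
    by (simp_all add: \<eta>_def)
  moreover have "\<eta> > 0"
    using \<epsilon> M(1) by (simp add: \<eta>_def)
  ultimately have \<eta>: "\<eta> > 0" "2 * M ^ 6 * \<eta> \<le> \<epsilon>" "M\<^sup>2 * \<eta> \<le> 1 / 2"
    using M(1) by (simp_all add: pos_le_divide_eq mult_ac)
  obtain \<delta> where g: "gauge_on a b \<delta>"
    and \<delta>: "\<And>S. fine_sum \<delta> ?F a b S \<Longrightarrow> S < \<eta>"
    using product_primitive_gauge[OF W \<eta>(1)] by blast
  let ?x = "\<lambda>t. product_integral V a t"
  have "(\<forall>i<m. t i \<in> U_dom V (\<xi> i) \<and> t (Suc i) \<in> U_dom V (\<xi> i)) \<and>
      (\<Sum>i<m. norm (?x (t (Suc i)) - ?x (t i)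
        - (U_of V (\<xi> i) (t (Suc i)) - U_of V (\<xi> i) (t i)) * ?x (\<xi> i))) < \<epsilon>"
    if p: "fine_partition \<delta> a b m t \<xi>" for m t \<xi>
  proof -
    let ?f = "\<lambda>i. ?F (\<xi> i) (t i) (\<xi> i) + ?F (\<xi> i) (\<xi> i) (t (Suc i))"
    let ?r = "\<lambda>i. ?x (t (Suc i)) - ?x (t i)
        - (U_of V (\<xi> i) (t (Suc i)) - U_of V (\<xi> i) (t i)) * ?x (\<xi> i)"
    have "?F x x x = 0" if "x \<in> {a..b}" for x
      using assms(3) inv[OF that] that by (simp add: primitive_error_def V1_def alg_inverse_right)
    then have sum: "(\<Sum>i<m. ?f i) < \<eta>"
      by (intro \<delta> fine_sum_split[OF p])
    have "t i \<in> U_dom V (\<xi> i) \<and> t (Suc i) \<in> U_dom V (\<xi> i) \<and> norm (?r i) \<le> 2 * M ^ 6 * ?f i"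
      if i: "i < m" for i
    proof -
      have x: "t i \<le> \<xi> i" "\<xi> i \<le> t (Suc i)"
        using p i unfolding fine_partition_def tagged_partition_def by auto
      have r: "t i \<in> {a..b}" "t (Suc i) \<in> {a..b}" "\<xi> i \<in> {a..b}"
        using x fine_partition_in_range[OF p, of i] fine_partition_in_range[OF p, of "Suc i"] i
        by auto
      \<comment> \<open>All errors are nonnegative, so smallness of the sum bounds each one, as the
        pointwise condition \<open>small\<close> demands.\<close>
      have "?f i \<le> (\<Sum>i<m. ?f i)"
        using i by (intro member_le_sum) (auto simp: primitive_error_nonneg)
      then have "?F (\<xi> i) (t i) (\<xi> i) \<le> \<eta>"
        using sum primitive_error_nonneg[of V W "\<xi> i" "\<xi> i" "t (Suc i)"] by linarith
      then have "M\<^sup>2 * ?F (\<xi> i) (t i) (\<xi> i) \<le> 1 / 2"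
        by (intro order_trans[OF mult_left_mono \<eta>(3)]) simp_all
      moreover have "V (\<xi> i) {\<xi> i..\<xi> i} = 1"
        using assms(3) r by (simp add: V1_def)
      ultimately have est: "t i \<in> U_dom V (\<xi> i)"
        "norm (W (t (Suc i)) - W (t i)
          - (U_of V (\<xi> i) (t (Suc i)) - U_of V (\<xi> i) (t i)) * W (\<xi> i)) \<le> 2 * M ^ 5 * ?f i"
        using inv M r x by (auto intro!: U_of_estimate)
      \<comment> \<open>\<open>product_integral V a\<close> is \<open>W\<close> times the constant
        inverse of \<open>W a\<close> on the right. Coefficients act from the left, so this constant
        factors out of the residual.\<close>
      have "?r i = (W (t (Suc i)) - W (t i)
          - (U_of V (\<xi> i) (t (Suc i)) - U_of V (\<xi> i) (t i)) * W (\<xi> i)) * alg_inverse (W a)"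
        using r by (simp add: product_integral_eq[OF W] algebra_simps)
      also have "norm \<dots> \<le> 2 * M ^ 5 * ?f i * M"
        using est(2) M(1) M(3)[of a] assms(1)
        by (intro order_trans[OF norm_mult_ineq] mult_mono) (auto simp: primitive_error_nonneg)
      also have "\<dots> = 2 * M ^ 6 * ?f i"
        by (simp add: power_numeral_reduce)
      \<comment> \<open>The right endpoint lies in \<open>U_dom\<close> because it is not below its
        tag.\<close>
      finally show ?thesis
        using est(1) x by (simp add: U_dom_def)
    qed
    note est = this
    have "(\<Sum>i<m. norm (?r i)) \<le> (\<Sum>i<m. 2 * M ^ 6 * ?f i)"
      using est by (intro sum_mono) auto
    also have "\<dots> = 2 * M ^ 6 * (\<Sum>i<m. ?f i)"
      by (simp add: sum_distrib_left)
    also have "\<dots> < 2 * M ^ 6 * \<eta>"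
      using sum M(1) by (intro mult_strict_left_mono) auto
    finally show ?thesis
      using est \<eta>(2) by auto
  qed
  then show "\<exists>\<delta>. gauge_on a b \<delta> \<and> (\<forall>m t \<xi>. fine_partition \<delta> a b m t \<xi> \<longrightarrow>
      (\<forall>i<m. t i \<in> U_dom V (\<xi> i) \<and> t (Suc i) \<in> U_dom V (\<xi> i)) \<and>
      (\<Sum>i<m. norm (?x (t (Suc i)) - ?x (t i)
        - (U_of V (\<xi> i) (t (Suc i)) - U_of V (\<xi> i) (t i)) * ?x (\<xi> i))) < \<epsilon>)"
    using g by blast
qed

end
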